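(* Let $\ell$ be an odd prime, $n$ a positive integer and $t$ an integer, and let $\Phi(x)=T_\ell^n(x)-t$. Then $\Phi(t)\equiv 0\pmod{\ell^2}$ if and only if there exists $a\in\mathbb{Z}/\ell^2\mathbb{Z}$ with $t\equiv T_\ell(a)\pmod{\ell^2}$.
   Context: $T_d(x)$ is the Chebyshev polynomial of the first kind of degree $d$ (the unique monic polynomial with $T_d(z+z^{-1})=z^d+z^{-d}$; it has integer coefficients), and $T_\ell^n$ denotes the $n$-fold composition of $T_\ell$; thus $\Phi(t)=T_\ell^n(t)-t$. *)

theory Defs
  imports "HOL-Computational_Algebra.Computational_Algebra" "HOL-Number_Theory.Cong"
begin

definition is_chebyshev :: "nat \<Rightarrow> int poly \<Rightarrow> bool" where
  "is_chebyshev d p \<longleftrightarrow>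
     lead_coeff p = 1 \<and>
     (\<forall>z::complex. z \<noteq> 0 \<longrightarrow> poly (map_poly of_int p) (z + inverse z) = z ^ d + inverse z ^ d)"

text \<open>
  The Chebyshev polynomial of the first kind in the normalisation
  \<open>T\<^sub>d(z + 1/z) = z\<^sup>d + 1/z\<^sup>d\<close> (the Dickson normalisation, so \<open>T\<^sub>2 = x\<^sup>2 - 2\<close>).
  Only \<open>d > 0\<close> is meaningful: for \<open>d = 0\<close> the identity forces the constant \<open>2\<close>, which is
  not monic. The lemma \<open>is_chebyshev_ex1\<close> below shows that the description is proper for \<open>d > 0\<close>.
\<close>
definition chebyshev :: "nat \<Rightarrow> int poly" where
  "chebyshev d = (THE p. is_chebyshev d p)"

definition poly_iterate :: "'a::comm_semiring_1 poly \<Rightarrow> nat \<Rightarrow> 'a poly" where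
  "poly_iterate p n = ((\<lambda>q. pcompose p q) ^^ n) [:0, 1:]"

definition Phi :: "nat \<Rightarrow> nat \<Rightarrow> int \<Rightarrow> int poly" where
  "Phi l n t = poly_iterate (chebyshev l) n - [:t:]"

lemma poly_poly_iterate: "poly (poly_iterate p n) x = (poly p ^^ n) x"
  by (induction n) (simp_all add: poly_iterate_def poly_pcompose)

lemma ex_add_inverse_eq: "\<exists>z::complex. z \<noteq> 0 \<and> z + inverse z = w"
proof -
  define s where "s = csqrt (w\<^sup>2 - 4)"
  define z where "z = (w + s) / 2"
  have "s\<^sup>2 = w\<^sup>2 - 4" by (simp add: s_def)
  then have *: "z * (w - z) = 1"
    by (simp add: z_def field_simps power2_eq_square)
  then have "z \<noteq> 0" by auto
  moreover from * have "inverse z = w - z" by (rule inverse_unique)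
  ultimately show ?thesis by (intro exI[of _ z]) simp
qed

lemma is_chebyshev_unique:
  assumes "is_chebyshev d p" "is_chebyshev d q"
  shows "p = q"
proof -
  have "poly (map_poly of_int p) w = poly (map_poly of_int q) w" for w :: complex
    using ex_add_inverse_eq[of w] assms unfolding is_chebyshev_def by metis
  then have "(map_poly of_int p :: complex poly) = map_poly of_int q"
    by (simp add: poly_eq_poly_eq_iff[symmetric] fun_eq_iff)
  then show ?thesis
    by (metis coeff_map_poly of_int_0 of_int_eq_iff poly_eqI)
qed

fun cheb_rec :: "nat \<Rightarrow> int poly" where
  "cheb_rec 0 = [:2:]"
| "cheb_rec (Suc 0) = [:0, 1:]"
| "cheb_rec (Suc (Suc d)) = [:0, 1:] * cheb_rec (Suc d) - cheb_rec d"

lemma poly_cheb_rec: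
  fixes z :: complex
  assumes "z \<noteq> 0"
  shows "poly (map_poly of_int (cheb_rec d)) (z + inverse z) = z ^ d + inverse z ^ d"
proof (induction d rule: cheb_rec.induct)
  case (3 d)
  have eq: "map_poly of_int (cheb_rec (Suc (Suc d))) =
      ([:0, 1:] * map_poly of_int (cheb_rec (Suc d)) - map_poly of_int (cheb_rec d) :: complex poly)"
    by (rule poly_eqI) (simp add: coeff_map_poly coeff_pCons split: nat.split)
  have "poly (map_poly of_int (cheb_rec (Suc (Suc d)))) (z + inverse z) =
      (z + inverse z) * (z ^ Suc d + inverse z ^ Suc d) - (z ^ d + inverse z ^ d)"
    unfolding eq by (simp only: poly_diff poly_mult 3) simp
  also have "\<dots> = z ^ Suc (Suc d) + inverse z ^ Suc (Suc d)"
    using assms by (simp add: field_simps)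
  finally show ?case .
qed (auto simp: map_poly_pCons)

lemma cheb_rec_monic: "degree (cheb_rec (Suc d)) = Suc d \<and> lead_coeff (cheb_rec (Suc d)) = 1"
proof (induction d rule: less_induct)
  case (less d)
  show ?case
  proof (cases d)
    case (Suc e)
    have IH: "degree (cheb_rec (Suc e)) = Suc e" "lead_coeff (cheb_rec (Suc e)) = 1"
      using less[of e] Suc by auto
    have low: "degree (cheb_rec e) \<le> e"
      using less[of "e - 1"] Suc by (cases e) auto
    have ne: "cheb_rec (Suc e) \<noteq> 0" using IH by auto
    have c: "coeff (cheb_rec (Suc (Suc e))) (Suc (Suc e)) = 1"
      using IH low by (simp add: coeff_eq_0)
    have "degree (cheb_rec (Suc (Suc e))) \<le> Suc (Suc e)"
      using IH low ne by (auto intro!: degree_diff_le)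
    with c have "degree (cheb_rec (Suc (Suc e))) = Suc (Suc e)"
      by (intro antisym le_degree) auto
    with c Suc show ?thesis by simp
  qed simp
qed

lemma is_chebyshev_ex1:
  assumes "d > 0"
  shows "\<exists>!p. is_chebyshev d p"
proof -
  from assms obtain e where "d = Suc e" by (cases d) auto
  then have "is_chebyshev d (cheb_rec d)"
    using cheb_rec_monic[of e] poly_cheb_rec by (auto simp: is_chebyshev_def)
  then show ?thesis using is_chebyshev_unique by blast
qed

lemma is_chebyshev_chebyshev: "d > 0 \<Longrightarrow> is_chebyshev d (chebyshev d)"
  unfolding chebyshev_def by (rule theI') (rule is_chebyshev_ex1)

end

theory Submission
  imports Defs "HOL-Number_Theory.Residues"
begin

text \<open>
  Pairing the terms \<open>k\<close> and \<open>l - k\<close> in the binomial expansion of \<open>(z + 1/z)\<^sup>l\<close> gives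
  \<open>x\<^sup>l = T\<^sub>l(x) + l Q(x)\<close> with an integer polynomial \<open>Q\<close>. Hence \<open>T\<^sub>l(x) \<equiv> x\<close> modulo \<open>l\<close> by Fermat,
  and \<open>T\<^sub>l(x)\<close> modulo \<open>l\<^sup>2\<close> depends only on \<open>x\<close> modulo \<open>l\<close>. So if \<open>t \<equiv> T\<^sub>l(a)\<close> modulo \<open>l\<^sup>2\<close>, then
  \<open>t \<equiv> a\<close> modulo \<open>l\<close> and \<open>T\<^sub>l(t) \<equiv> T\<^sub>l(a) \<equiv> t\<close> modulo \<open>l\<^sup>2\<close>: \<open>t\<close> is a fixed point of \<open>T\<^sub>l\<close>
  modulo \<open>l\<^sup>2\<close>. Conversely a fixed point of an iterate of \<open>T\<^sub>l\<close> lies in the image of \<open>T\<^sub>l\<close>.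
\<close>

lemma poly_map_poly_of_int: "poly (map_poly of_int p) (of_int x :: 'a::comm_ring_1) = of_int (poly p x)"
  by (induction p) (simp_all add: map_poly_pCons)

lemma poly_cong:
  fixes x y m :: int
  assumes "[x = y] (mod m)"
  shows "[poly p x = poly p y] (mod m)"
  using assms by (induction p) (simp_all add: cong_add cong_mult)

text \<open>In \<open>x^m - y^m = (x - y) * S\<close> both factors are divisible by
  \<open>m\<close>. For \<open>m \<le> 0\<close> the exponent \<open>nat m\<close> is 0 and both
  powers are 1.\<close>

lemma cong_power_lift:
  fixes x y m :: int
  assumes "[x = y] (mod m)"
  shows "[x ^ nat m = y ^ nat m] (mod m\<^sup>2)"
proof (cases "m > 0")
  case True
  then obtain n where n: "nat m = Suc n" by (cases "nat m") auto
  \<comment> \<open>Replacing \<open>x\<close> by \<open>y\<close> makes each of the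
    \<open>m\<close> summands equal to \<open>y^(m-1)\<close>, so the sum vanishes modulo
    \<open>m\<close>.\<close>
  have "[(\<Sum>p<Suc n. x ^ p * y ^ (n - p)) = (\<Sum>p<Suc n. y ^ p * y ^ (n - p))] (mod m)"
    by (intro cong_sum cong_mult cong_pow assms cong_refl)
  also have "(\<Sum>p<Suc n. y ^ p * y ^ (n - p)) = (\<Sum>p<Suc n. y ^ n)"
    by (intro sum.cong) (simp_all flip: power_add)
  also have "\<dots> = int (nat m) * y ^ n"
    by (simp only: n sum_constant card_lessThan)
  also have "\<dots> = m * y ^ n"
    using True by simp
  finally have "m dvd (\<Sum>p<Suc n. x ^ p * y ^ (n - p))"
    by (simp add: cong_dvd_iff)
  moreover have "m dvd x - y"
    using assms by (simp add: cong_iff_dvd_diff)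
  ultimately have "m\<^sup>2 dvd (x - y) * (\<Sum>p<Suc n. x ^ p * y ^ (n - p))"
    unfolding power2_eq_square by (rule mult_dvd_mono[rotated])
  then show ?thesis
    by (simp only: cong_iff_dvd_diff n diff_power_eq_sum)
qed simp

lemma fermat_little_int:
  fixes x :: int
  assumes "prime l"
  shows "[x ^ l = x] (mod int l)"
proof (cases "int l dvd x")
  case True
  then show ?thesis
    using prime_gt_0_nat[OF assms] by (metis cong_def cong_pow cong_0_iff zero_power)
next
  case False
  \<comment> \<open>\<open>fermat_theorem\<close> speaks of naturals, so \<open>x\<close> is
    replaced by its residue.\<close>
  define a where "a = nat (x mod int l)"
  have l: "l > 0" using prime_gt_0_nat[OF assms] .
  then have a: "int a = x mod int l" by (simp add: a_def)
  have "\<not> l dvd a"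
    using False l by (metis a dvd_mod_iff dvd_refl int_dvd_int_iff)
  then have "[a ^ (l - 1) = 1] (mod l)"
    by (rule fermat_theorem[OF assms])
  then have "[int a ^ (l - 1) = 1] (mod int l)"
    by (metis cong_int_iff of_nat_1 of_nat_power)
  then have "[x ^ (l - 1) = 1] (mod int l)"
    by (simp add: a cong_def power_mod)
  then have "[x * x ^ (l - 1) = x * 1] (mod int l)"
    by (intro cong_mult cong_refl)
  then show ?thesis
    using l by (simp flip: power_Suc)
qed

text \<open>The exponent is odd, so the binomial expansion has no middle term and splits into
  \<open>m + 1\<close> pairs. The computation takes place over the complex numbers, where
  \<open>x = z + 1/z\<close> is solvable, and descends because \<open>of_int\<close> is
  injective.\<close>

lemma power_eq_sum_cheb_rec:
  fixes x :: int
  shows "x ^ (2 * m + 1) =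
    (\<Sum>k\<le>m. int ((2 * m + 1) choose k) * poly (cheb_rec (2 * m + 1 - 2 * k)) x)"
proof -
  let ?l = "2 * m + 1"
  obtain z :: complex where z: "z \<noteq> 0" "z + inverse z = of_int x"
    using ex_add_inverse_eq by blast
  define f where "f k = of_nat (?l choose k) * z ^ k * inverse z ^ (?l - k)" for k
  have cheb: "of_int (poly (cheb_rec d) x) = z ^ d + inverse z ^ d" for d
    using poly_cheb_rec[OF z(1), of d] by (simp add: z(2) poly_map_poly_of_int)
  have pair: "f k + f (?l - k) =
      of_int (int (?l choose k) * poly (cheb_rec (?l - 2 * k)) x)" if "k \<le> m" for k
  proof -
    \<comment> \<open>For \<open>k \<le> m\<close> the subtractions are not truncated, and
      \<open>z^k\<close> cancels against \<open>k\<close> of the \<open>l - k\<close> inverse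
      factors.\<close>
    have k: "?l - k = k + (?l - 2 * k)" "?l - (?l - k) = k"
      using that by auto
    have "z ^ k * inverse z ^ k = 1"
      using z(1) by (simp flip: power_mult_distrib)
    then have "z ^ k * inverse z ^ (?l - k) = inverse z ^ (?l - 2 * k)"
      "z ^ (?l - k) * inverse z ^ k = z ^ (?l - 2 * k)"
      unfolding k(1) power_add by (simp_all add: mult_ac)
    moreover have "(?l choose (?l - k)) = (?l choose k)"
      using that by (intro binomial_symmetric[symmetric]) simp
    ultimately show ?thesis
      by (simp only: f_def k(2) of_int_mult of_int_of_nat_eq cheb mult.assoc distrib_left
          add.commute[of "z ^ (?l - 2 * k)"])
  qed
  have "of_int (x ^ ?l) = (z + inverse z) ^ ?l"
    by (simp add: z)
  also have "\<dots> = (\<Sum>k\<le>?l. f k)"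
    by (simp only: f_def binomial_ring)
  also have "\<dots> = (\<Sum>k\<le>m. f k) + (\<Sum>k\<in>{m<..?l}. f k)"
    by (subst sum.union_disjoint[symmetric]) (simp_all add: ivl_disj_int ivl_disj_un del: sum.atMost_Suc)
  also have "(\<Sum>k\<in>{m<..?l}. f k) = (\<Sum>k\<le>m. f (?l - k))"
    by (rule sum.reindex_bij_witness[of _ "\<lambda>k. ?l - k" "\<lambda>k. ?l - k"]) auto
  also have "(\<Sum>k\<le>m. f k) + \<dots> =
      of_int (\<Sum>k\<le>m. int (?l choose k) * poly (cheb_rec (?l - 2 * k)) x)"
    by (simp only: sum.distrib[symmetric] of_int_sum) (intro sum.cong refl pair, simp)
  finally show ?thesis
    by (simp only: of_int_eq_iff)
qed

lemma chebyshev_eq_cheb_rec: "d > 0 \<Longrightarrow> chebyshev d = cheb_rec d"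
  by (rule is_chebyshev_unique[OF is_chebyshev_chebyshev])
    (use cheb_rec_monic[of "d - 1"] poly_cheb_rec in \<open>auto simp: is_chebyshev_def\<close>)

text \<open>The term \<open>k = 0\<close> is the Chebyshev polynomial itself; in all others
  \<open>0 < k < l\<close>, so the prime \<open>l\<close> divides the binomial coefficient and the
  \<open>div\<close> in \<open>q\<close> is exact.\<close>

lemma chebyshev_prime_decomposition:
  assumes "prime l" "odd l"
  obtains q where "\<And>x. poly (chebyshev l) x = x ^ l - int l * poly q x"
proof -
  from assms(2) obtain m where m: "l = 2 * m + 1" by (elim oddE)
  define q where "q = (\<Sum>k\<in>{1..m}. Polynomial.smult (int ((l choose k) div l)) (cheb_rec (l - 2 * k)))"
  have "poly (chebyshev l) x = x ^ l - int l * poly q x" for x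
  proof -
    have "x ^ l = (\<Sum>k\<le>m. int (l choose k) * poly (cheb_rec (l - 2 * k)) x)"
      unfolding m by (rule power_eq_sum_cheb_rec)
    also have "{..m} = insert 0 {1..m}" by auto
    also have "(\<Sum>k\<in>\<dots>. int (l choose k) * poly (cheb_rec (l - 2 * k)) x) =
        poly (chebyshev l) x + (\<Sum>k\<in>{1..m}. int (l choose k) * poly (cheb_rec (l - 2 * k)) x)"
      by (simp add: chebyshev_eq_cheb_rec m)
    also have "(\<Sum>k\<in>{1..m}. int (l choose k) * poly (cheb_rec (l - 2 * k)) x) = int l * poly q x"
      unfolding q_def poly_sum sum_distrib_left
    proof (intro sum.cong refl)
      fix k assume "k \<in> {1..m}"
      then have "l dvd (l choose k)"
        using assms(1) m by (intro dvd_choose_prime) auto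
      then have "int (l choose k) = int l * int ((l choose k) div l)"
        by (metis dvd_mult_div_cancel of_nat_mult)
      then show "int (l choose k) * poly (cheb_rec (l - 2 * k)) x =
          int l * poly (Polynomial.smult (int ((l choose k) div l)) (cheb_rec (l - 2 * k))) x"
        by simp
    qed
    finally show ?thesis by simp
  qed
  then show ?thesis by (rule that)
qed

lemma chebyshev_prime_cong_self:
  assumes "prime l" "odd l"
  shows "[poly (chebyshev l) x = x] (mod int l)"
proof -
  obtain q where q: "\<And>x. poly (chebyshev l) x = x ^ l - int l * poly q x"
    using chebyshev_prime_decomposition[OF assms] by blast
  have "[x ^ l - int l * poly q x = x - 0] (mod int l)"
    by (intro cong_diff fermat_little_int assms) (simp add: cong_0_iff)
  then show ?thesis by (simp add: q)
qed

text \<open>Both parts of the decomposition gain a factor \<open>l\<close>: the power by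
  \<open>cong_power_lift\<close>, the rest from its coefficient \<open>l\<close>.\<close>

lemma chebyshev_prime_cong_lift:
  assumes "prime l" "odd l" and xy: "[x = y] (mod int l)"
  shows "[poly (chebyshev l) x = poly (chebyshev l) y] (mod (int l)\<^sup>2)"
proof -
  obtain q where q: "\<And>x. poly (chebyshev l) x = x ^ l - int l * poly q x"
    using chebyshev_prime_decomposition[OF assms(1,2)] by blast
  have "int l dvd poly q x - poly q y"
    using poly_cong[OF xy] by (simp add: cong_iff_dvd_diff)
  then have "[int l * poly q x = int l * poly q y] (mod (int l)\<^sup>2)"
    by (simp add: cong_iff_dvd_diff power2_eq_square flip: right_diff_distrib)
  moreover have "[x ^ l = y ^ l] (mod (int l)\<^sup>2)"
    using cong_power_lift[OF xy] by simp
  ultimately show ?thesis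
    by (simp add: q cong_diff)
qed

theorem theorem3p6:
  fixes l n :: nat and t :: int
  assumes "prime l" and "odd l" and "n > 0"
  shows "[poly (Phi l n t) t = 0] (mod (int l)\<^sup>2) \<longleftrightarrow>
         (\<exists>a\<in>{0..<(int l)\<^sup>2}. [t = poly (chebyshev l) a] (mod (int l)\<^sup>2))"
proof -
  let ?T = "poly (chebyshev l)" and ?M = "(int l)\<^sup>2"
  have M: "?M > 0" using prime_gt_0_nat[OF assms(1)] by simp
  have Phi: "[poly (Phi l n t) t = 0] (mod ?M) \<longleftrightarrow> [(?T ^^ n) t = t] (mod ?M)"
    by (simp add: Phi_def poly_poly_iterate cong_iff_dvd_diff)
  show ?thesis unfolding Phi
  proof
    assume fixed: "[(?T ^^ n) t = t] (mod ?M)"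
    \<comment> \<open>As \<open>n > 0\<close>, one application of \<open>?T\<close> can be split off
      on the outside; what remains, reduced modulo \<open>?M\<close>, is the witness.\<close>
    define b where "b = (?T ^^ (n - 1)) t"
    have "(?T ^^ n) t = ?T b"
      using assms(3) by (cases n) (simp_all add: b_def)
    moreover have "[?T b = ?T (b mod ?M)] (mod ?M)"
      by (intro poly_cong) simp
    ultimately have "[t = ?T (b mod ?M)] (mod ?M)"
      using fixed by (metis cong_sym cong_trans)
    then show "\<exists>a\<in>{0..<?M}. [t = ?T a] (mod ?M)"
      using M by (intro bexI[of _ "b mod ?M"]) simp_all
  next
    assume "\<exists>a\<in>{0..<?M}. [t = ?T a] (mod ?M)"
    then obtain a where a: "[t = ?T a] (mod ?M)" by blast
    then have "[t = ?T a] (mod int l)"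
      by (rule cong_dvd_modulus) simp
    then have "[t = a] (mod int l)"
      using chebyshev_prime_cong_self[OF assms(1,2)] by (rule cong_trans)
    then have "[?T t = ?T a] (mod ?M)"
      by (rule chebyshev_prime_cong_lift[OF assms(1,2)])
    then have Tt: "[?T t = t] (mod ?M)"
      using a by (metis cong_sym cong_trans)
    \<comment> \<open>A fixed point of \<open>?T\<close> modulo \<open>?M\<close> is fixed by every
      iterate.\<close>
    show "[(?T ^^ n) t = t] (mod ?M)"
    proof (induction n)
      case (Suc n)
      then have "[?T ((?T ^^ n) t) = ?T t] (mod ?M)" by (rule poly_cong)
      then show ?case using Tt by (simp add: cong_trans)
    qed simp
  qed
qed

end
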